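(* Let $G$ be a simple graph with $n$ vertices and $m$ edges that has at least one perfect 2-matching. Then the number of edge-signings $s\in\{\pm1\}^{E(G)}$ for which the signed adjacency matrix $A(s)$ is invertible is at least $2^{m-n}/n!$.
   Context: Let $A$ be the adjacency matrix of $G$. For $s\in\{\pm1\}^{E(G)}$, the signed adjacency matrix $A(s)$ is the $n\times n$ symmetric matrix with $A(s)[i,j]=A(s)[j,i]=s(\{i,j\})$ if $\{i,j\}$ is an edge of $G$ and $0$ otherwise. A perfect 2-matching in a graph with edge set $E$ is an assignment $x:E\to\{0,1,2\}$ such that $\sum_{e\in\delta(v)}x_e=2$ for every vertex $v$, where $\delta(v)$ is the set of edges incident to $v$. *)

theory Defs
  imports "HOL-Analysis.Analysis" "HOL-Library.FuncSet"
begin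

(* A simple graph is given by its edge set; its vertex set is the whole finite type 'n. *)
definition simple_graph :: "'n::finite set set \<Rightarrow> bool" where
  "simple_graph E \<longleftrightarrow> (\<forall>e\<in>E. card e = 2)"

definition incident_edges :: "'n set set \<Rightarrow> 'n \<Rightarrow> 'n set set" where
  "incident_edges E v = {e \<in> E. v \<in> e}"

definition perfect_2_matching :: "'n::finite set set \<Rightarrow> ('n set \<Rightarrow> nat) \<Rightarrow> bool" where
  "perfect_2_matching E x \<longleftrightarrow>
     (\<forall>e\<in>E. x e \<in> {0, 1, 2}) \<and> (\<forall>v. (\<Sum>e\<in>incident_edges E v. x e) = 2)"

(* Extensional functions, so that distinct elements differ on some edge and
   the cardinality of a set of signings is the intended count. *)
definition edge_signings :: "'n set set \<Rightarrow> ('n set \<Rightarrow> real) set" where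
  "edge_signings E = E \<rightarrow>\<^sub>E {-1, 1}"

definition signed_adjacency_matrix ::
    "'n::finite set set \<Rightarrow> ('n set \<Rightarrow> real) \<Rightarrow> real ^ 'n ^ 'n" where
  "signed_adjacency_matrix E s = (\<chi> i j. if {i, j} \<in> E then s {i, j} else 0)"

end

theory Submission
  imports Defs
begin

text \<open>
  By Hall's theorem a perfect 2-matching yields a permutation \<open>p\<close> of the vertices with
  \<open>{i, p i} \<in> E\<close> for all \<open>i\<close>. Multiply the Leibniz expansion of \<open>det A(s)\<close> by the character
  \<open>\<Prod>i. s {i, p i}\<close> and sum over all signings \<open>s\<close>: a permutation \<open>q\<close> survives, with
  contribution \<open>sign q * 2^m\<close>, only if \<open>q\<close> traverses every edge with the same parity as \<open>p\<close>.
  Such a \<open>q\<close> has the same cycles of length at least 3 as \<open>p\<close> up to reversal, and both \<open>p\<close> and \<open>q\<close>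
  act on the remaining vertices as fixed-point-free involutions, so \<open>sign q = sign p\<close>. Hence
  nothing cancels, and \<open>2^m \<le> (\<Sum>s. \<bar>det A(s)\<bar>)\<close>, whereas \<open>\<bar>det A(s)\<bar> \<le> n!\<close>. This gives the bound
  \<open>2^m / n!\<close>, which is stronger than the one claimed.
\<close>

section \<open>Hall's theorem\<close>

text \<open>If deleting \<open>x\<close> and deleting \<open>y\<close> both broke the condition,
  then \<open>card ?P + card ?Q\<close> would be at most \<open>card J + card K\<close>. Hall's
  condition for \<open>insert k (J \<union> K)\<close> and for \<open>J \<inter> K\<close> forces at
  least one more, by inclusion-exclusion.\<close>

lemma Hall_condition_remove_element:
  fixes A :: "'i \<Rightarrow> 'a set"
  assumes "finite I" and fin: "\<And>i. i \<in> I \<Longrightarrow> finite (A i)"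
    and hall: "\<And>J. J \<subseteq> I \<Longrightarrow> card J \<le> card (\<Union>(A ` J))"
    and k: "k \<in> I" and xy: "x \<in> A k" "y \<in> A k" "x \<noteq> y"
  shows "\<exists>z\<in>A k. \<forall>J\<subseteq>I. card J \<le> card (\<Union>((A(k := A k - {z})) ` J))"
proof (rule ccontr)
  assume contr: "\<not> ?thesis"
  \<comment> \<open>A violating family must contain \<open>k\<close>, the only index whose set
    shrinks; dropping \<open>k\<close> from it turns the strict inequality into a weak one.\<close>
  have viol: "\<exists>J\<subseteq>I - {k}. card (\<Union>(A ` J) \<union> (A k - {z})) \<le> card J" if "z \<in> A k" for z
  proof -
    from contr that obtain J where J: "J \<subseteq> I" "card (\<Union>((A(k := A k - {z})) ` J)) < card J"
      by (meson not_le)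
    have "k \<in> J"
    proof (rule ccontr)
      assume "k \<notin> J"
      then have "\<Union>((A(k := A k - {z})) ` J) = \<Union>(A ` J)" by auto
      with J hall[of J] show False by simp
    qed
    have "\<Union>((A(k := A k - {z})) ` J) = \<Union>(A ` (J - {k})) \<union> (A k - {z})"
      using \<open>k \<in> J\<close> by (auto split: if_splits)
    with J have "card (\<Union>(A ` (J - {k})) \<union> (A k - {z})) < card J" by simp
    moreover have "card J = Suc (card (J - {k}))"
      using \<open>k \<in> J\<close> J(1) \<open>finite I\<close> by (metis card_Suc_Diff1 finite_subset)
    ultimately show ?thesis using J(1) by (intro exI[of _ "J - {k}"]) auto
  qed
  obtain J where J: "J \<subseteq> I - {k}" "card (\<Union>(A ` J) \<union> (A k - {x})) \<le> card J"
    using viol xy by blast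
  obtain K where K: "K \<subseteq> I - {k}" "card (\<Union>(A ` K) \<union> (A k - {y})) \<le> card K"
    using viol xy by blast
  let ?P = "\<Union>(A ` J) \<union> (A k - {x})" and ?Q = "\<Union>(A ` K) \<union> (A k - {y})"
  have fJK: "finite J" "finite K" using J K \<open>finite I\<close> by (auto dest: finite_subset)
  have fPQ: "finite ?P" "finite ?Q" using J K fJK fin k by auto
  have "card (insert k (J \<union> K)) \<le> card (\<Union>(A ` insert k (J \<union> K)))"
    using hall J K k by (intro hall) auto
  moreover have "\<Union>(A ` insert k (J \<union> K)) = ?P \<union> ?Q" using xy by auto
  moreover have "card (insert k (J \<union> K)) = Suc (card (J \<union> K))"
    using J K fJK by (subst card_insert_disjoint) auto
  moreover have "card (J \<inter> K) \<le> card (\<Union>(A ` (J \<inter> K)))"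
    using J by (intro hall) auto
  moreover have "card (\<Union>(A ` (J \<inter> K))) \<le> card (?P \<inter> ?Q)"
    using fPQ by (intro card_mono) auto
  moreover have "card (J \<union> K) + card (J \<inter> K) = card J + card K"
    using card_Un_Int[OF fJK] by simp
  moreover have "card (?P \<union> ?Q) + card (?P \<inter> ?Q) = card ?P + card ?Q"
    using card_Un_Int[OF fPQ] by simp
  ultimately show False using J(2) K(2) by simp
qed

text \<open>Rado's proof: shrink the sets one element at a time until all are singletons.\<close>

theorem Hall_marriage:
  fixes A :: "'i \<Rightarrow> 'a set"
  assumes "finite I" and "\<And>i. i \<in> I \<Longrightarrow> finite (A i)"
    and "\<And>J. J \<subseteq> I \<Longrightarrow> card J \<le> card (\<Union>(A ` J))"
  shows "\<exists>f. inj_on f I \<and> (\<forall>i\<in>I. f i \<in> A i)"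
  using assms
proof (induction "\<Sum>i\<in>I. card (A i)" arbitrary: A rule: less_induct)
  case less
  note fin = less.prems(2) and hall = less.prems(3)
  show ?case
  proof (cases "\<exists>k\<in>I. \<exists>x\<in>A k. \<exists>y\<in>A k. x \<noteq> y")
    case True
    then obtain k x y where k: "k \<in> I" and xy: "x \<in> A k" "y \<in> A k" "x \<noteq> y" by blast
    obtain z where z: "z \<in> A k" "\<And>J. J \<subseteq> I \<Longrightarrow> card J \<le> card (\<Union>((A(k := A k - {z})) ` J))"
      using Hall_condition_remove_element[of I A k x y] less.prems k xy by blast
    let ?B = "A(k := A k - {z})"
    have "(\<Sum>i\<in>I. card (?B i)) < (\<Sum>i\<in>I. card (A i))"
    proof (rule sum_strict_mono_ex1)
      show "\<forall>i\<in>I. card (?B i) \<le> card (A i)" using fin by (auto intro: card_mono)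
      show "\<exists>i\<in>I. card (?B i) < card (A i)"
        using card_Diff1_less[OF fin[OF k] z(1)] k by (intro bexI[of _ k]) auto
    qed fact
    moreover have "finite (?B i)" if "i \<in> I" for i using fin that by auto
    ultimately obtain f where "inj_on f I" "\<forall>i\<in>I. f i \<in> ?B i"
      using less.hyps[of ?B] less.prems(1) z(2) by blast
    then show ?thesis by (metis Diff_iff fun_upd_apply)
  next
    case False
    have "\<exists>x. A i = {x}" if "i \<in> I" for i
    proof -
      have "A i \<noteq> {}" using hall[of "{i}"] that by auto
      then obtain x where "x \<in> A i" by blast
      with False that have "A i = {x}" by blast
      then show ?thesis ..
    qed
    then obtain f where f: "\<And>i. i \<in> I \<Longrightarrow> A i = {f i}" by metis
    have "inj_on f I"
    proof (rule inj_onI, rule ccontr)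
      fix i j assume "i \<in> I" "j \<in> I" "f i = f j" "i \<noteq> j"
      then show False using hall[of "{i, j}"] f[of i] f[of j] by auto
    qed
    with f show ?thesis by auto
  qed
qed

section \<open>A permutation along the edges\<close>

text \<open>Hall's condition follows by double counting: \<open>X\<close> is symmetric with all row
  sums 2, and its rows in \<open>J\<close> are supported on the columns in \<open>?N\<close>, so
  \<open>2 * card J\<close> is at most \<open>2 * card ?N\<close>. On a finite type the resulting
  injection is a permutation.\<close>

lemma perfect_2_matching_imp_permutation:
  fixes E :: "'n::finite set set"
  assumes "simple_graph E" and "perfect_2_matching E x"
  shows "\<exists>p. p permutes UNIV \<and> (\<forall>i. {i, p i} \<in> E)"
proof -
  define X where "X i j = (if {i, j} \<in> E then x {i, j} else 0)" for i j
  have X_sym: "X i j = X j i" for i j by (simp add: X_def insert_commute)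
  have X_row: "(\<Sum>j\<in>UNIV. X i j) = 2" for i
  proof -
    \<comment> \<open>An edge at \<open>i\<close> has two elements, so it is given by its other end;
      this turns the matching condition at \<open>i\<close> into a row sum of
      \<open>X\<close>.\<close>
    have "bij_betw (\<lambda>j. {i, j}) {j. {i, j} \<in> E} (incident_edges E i)"
    proof (rule bij_betwI')
      fix e assume "e \<in> incident_edges E i"
      then have "e \<in> E" "i \<in> e" "card e = 2"
        using assms(1) by (auto simp: incident_edges_def simple_graph_def)
      then show "\<exists>j\<in>{j. {i, j} \<in> E}. e = {i, j}" by (auto simp: card_2_iff insert_commute)
    qed (auto simp: incident_edges_def doubleton_eq_iff)
    then have "(\<Sum>e\<in>incident_edges E i. x e) = (\<Sum>j\<in>{j. {i, j} \<in> E}. x {i, j})"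
      by (rule sum.reindex_bij_betw[symmetric])
    also have "\<dots> = (\<Sum>j\<in>UNIV. X i j)"
      by (simp add: X_def sum.If_cases)
    finally show ?thesis using assms(2) by (simp add: perfect_2_matching_def)
  qed
  have "card J \<le> card (\<Union>i\<in>J. {j. {i, j} \<in> E})" for J :: "'n set"
  proof -
    let ?N = "\<Union>i\<in>J. {j. {i, j} \<in> E}"
    have "2 * card J = (\<Sum>i\<in>J. \<Sum>j\<in>UNIV. X i j)" by (simp add: X_row)
    also have "\<dots> = (\<Sum>i\<in>J. \<Sum>j\<in>?N. X i j)"
      by (intro sum.cong refl sum.mono_neutral_right) (auto simp: X_def)
    also have "\<dots> = (\<Sum>j\<in>?N. \<Sum>i\<in>J. X j i)"
      by (subst sum.swap) (simp add: X_sym)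
    also have "\<dots> \<le> (\<Sum>j\<in>?N. \<Sum>i\<in>UNIV. X j i)"
      by (intro sum_mono sum_mono2) auto
    also have "\<dots> = 2 * card ?N" by (simp add: X_row)
    finally show ?thesis by simp
  qed
  then obtain f where "inj f" "\<forall>i. f i \<in> {j. {i, j} \<in> E}"
    using Hall_marriage[of "UNIV :: 'n set" "\<lambda>i. {j. {i, j} \<in> E}"] by auto
  then show ?thesis
    using finite_UNIV_inj_surj[of f] by (auto intro!: exI[of _ f] bij_imp_permutes simp: bij_def)
qed

section \<open>Permutations with the same edge parities\<close>

lemma sign_on_Un:
  assumes "finite A" "finite B" "A \<inter> B = {}" "bij_betw f A A" "bij_betw f B B"
  shows "sign_on (A \<union> B) f = sign_on A f * sign_on B f"
proof -
  have "restrict_id f (A \<union> B) = restrict_id f A \<circ> restrict_id f B"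
    using assms by (auto simp: fun_eq_iff restrict_id_def bij_betw_def)
  moreover have "permutation (restrict_id f A)" "permutation (restrict_id f B)"
    using assms by (meson permutes_imp_permutation permutes_restrict_id)+
  ultimately show ?thesis by (simp add: sign_on_def sign_compose)
qed

text \<open>Each 2-cycle \<open>{a, f a}\<close> is peeled off with a factor -1. The value depends
  on \<open>card R\<close> alone, so two such involutions of one set have equal sign, however they
  pair its points.\<close>

lemma sign_on_fixpoint_free_involution:
  assumes "finite R" "\<And>x. x \<in> R \<Longrightarrow> f x \<in> R" "\<And>x. x \<in> R \<Longrightarrow> f (f x) = x"
    "\<And>x. x \<in> R \<Longrightarrow> f x \<noteq> x"
  shows "sign_on R f = (-1) ^ (card R div 2)"
  using assms
proof (induction "card R" arbitrary: R rule: less_induct)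
  case less
  show ?case
  proof (cases "R = {}")
    case True
    have "restrict_id f {} = id" by (auto simp: restrict_id_def fun_eq_iff)
    with True show ?thesis by (simp add: sign_on_def)
  next
    case False
    then obtain a where a: "a \<in> R" by blast
    define b where "b = f a"
    have b: "b \<in> R" "f b = a" "a \<noteq> b" using a less.prems(2-4)[of a] by (auto simp: b_def)
    define S where "S = R - {a, b}"
    have fS: "f x \<in> S" if "x \<in> S" for x
    proof -
      have "x \<in> R" "x \<noteq> a" "x \<noteq> b" using that by (auto simp: S_def)
      moreover from this have "f x \<noteq> a" "f x \<noteq> b"
        using less.prems(3) b by (metis b_def)+
      ultimately show ?thesis using less.prems by (auto simp: S_def)
    qed
    have ff: "f (f x) = x" if "x \<in> S" for x using that less.prems by (auto simp: S_def)
    have R: "R = {a, b} \<union> S" "{a, b} \<inter> S = {}" "finite S"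
      using a b less.prems by (auto simp: S_def)
    have cR: "card R = Suc (Suc (card S))" using R b by (subst R(1)) (auto simp: card_Un_disjoint)
    have "bij_betw f S S" by (rule bij_betwI[of _ _ _ f]) (auto simp: fS ff)
    moreover have "bij_betw f {a, b} {a, b}"
      using b by (auto simp: bij_betw_def b_def[symmetric])
    ultimately have "sign_on R f = sign_on {a, b} f * sign_on S f"
      using R(2,3) by (subst R(1), intro sign_on_Un) auto
    also have "sign_on {a, b} f = sign_on {a, b} (Transposition.transpose a b)"
    proof (rule sign_on_cong)
      show "f x = Transposition.transpose a b x" if "x \<in> {a, b}" for x
        using that b(2) b_def[symmetric] by fastforce
    qed simp
    also have "\<dots> = -1" using b by (intro sign_on_transpose) auto
    also have "sign_on S f = (-1) ^ (card S div 2)"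
      using less.prems cR by (intro less.hyps fS ff) (auto simp: S_def)
    finally show ?thesis using cR by simp
  qed
qed

text \<open>For distinct \<open>v\<close> and \<open>w\<close>, \<open>parity\<close> says that
  \<open>p\<close> uses the pair exactly once iff \<open>q\<close> does. Signs are compared on three
  invariant sets: the maps agree on \<open>T\<close>, are mutually inverse on \<open>U\<close>, and
  are both involutions on \<open>R\<close>.\<close>

lemma sign_eq_if_same_edge_parity:
  fixes p q :: "'n::finite \<Rightarrow> 'n"
  assumes p: "p permutes UNIV" and q: "q permutes UNIV"
    and nofix: "\<And>v. p v \<noteq> v" "\<And>v. q v \<noteq> v"
    and parity: "\<And>v w. (p v = w \<longleftrightarrow> p w = v) \<longleftrightarrow> (q v = w \<longleftrightarrow> q w = v)"
  shows "sign p = sign q"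
proof -
  have pinj: "p v = p w \<longleftrightarrow> v = w" and qinj: "q v = q w \<longleftrightarrow> v = w" for v w
    using permutes_inj[OF p] permutes_inj[OF q] by (auto simp: inj_eq)
  \<comment> \<open>\<open>T\<close> and \<open>U\<close> consist of the cycles of \<open>p\<close>
    of length at least 3, split by whether \<open>q\<close> follows or reverses them;
    \<open>R\<close> collects the 2-cycles.\<close>
  define T where "T = {v. p (p v) \<noteq> v \<and> q v = p v}"
  define U where "U = {v. p (p v) \<noteq> v \<and> q v \<noteq> p v}"
  define R where "R = {v. p (p v) = v}"
  \<comment> \<open>Here \<open>p\<close> uses the pair \<open>{v, p v}\<close> only once, so
    \<open>q\<close> uses it in exactly one direction.\<close>
  have qp: "q v = p v \<or> q (p v) = v" if "p (p v) \<noteq> v" for v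
    using parity[of v "p v"] that by blast
  have R_q: "p (p v) = v \<longleftrightarrow> q (q v) = v" for v
  proof
    assume *: "p (p v) = v"
    \<comment> \<open>So \<open>p\<close> uses \<open>{v, q v}\<close> never or twice; by parity so
      does \<open>q\<close>, which uses it at least once.\<close>
    have "p v = q v \<longleftrightarrow> p (q v) = v" using pinj[of "q v" "p v"] * by auto
    then show "q (q v) = v" using parity[of v "q v"] by blast
  next
    assume *: "q (q v) = v"
    have "q v = p v \<longleftrightarrow> q (p v) = v" using qinj[of "p v" "q v"] * by auto
    then show "p (p v) = v" using parity[of v "p v"] by blast
  qed
  \<comment> \<open>The direction cannot change along a cycle:
    \<open>q (p (p v)) = p v = q v\<close> would give \<open>p (p v) = v\<close> by
    injectivity.\<close>
  have pT: "p v \<in> T" if "v \<in> T" for v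
    using that qp[of "p v"] pinj qinj by (auto simp: T_def) metis
  have pU: "p v \<in> U" if "v \<in> U" for v
    using that qp[of v] pinj by (auto simp: U_def)
  have pR: "p v \<in> R" if "v \<in> R" for v
    using that by (auto simp: R_def)
  have bij: "bij_betw f S S" if "f permutes UNIV" "\<And>v. v \<in> S \<Longrightarrow> f v \<in> S"
    for f :: "'n \<Rightarrow> 'n" and S
  proof -
    have "inj_on f S" using that(1) inj_on_subset permutes_inj by blast
    moreover from this have "f ` S = S" using that(2) by (intro endo_inj_surj) auto
    ultimately show ?thesis by (simp add: bij_betw_def)
  qed
  have bij_p: "bij_betw p T T" "bij_betw p U U" "bij_betw p R R"
    using bij[OF p] pT pU pR by auto
  have q_inv: "q (p v) = v" if "v \<in> U" for v using that qp[of v] by (auto simp: U_def)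
  have qT: "q v \<in> T" if "v \<in> T" for v using that pT[OF that] by (auto simp: T_def)
  have qU: "q v \<in> U" if "v \<in> U" for v
  proof -
    from that bij_p(2) obtain u where "u \<in> U" "v = p u" by (auto simp: bij_betw_def)
    with q_inv show ?thesis by auto
  qed
  have qR: "q v \<in> R" if "v \<in> R" for v
    using that by (auto simp: R_def R_q)
  have bij_q: "bij_betw q T T" "bij_betw q U U" "bij_betw q R R"
    using bij[OF q] qT qU qR by auto
  have split: "sign f = sign_on T f * sign_on U f * sign_on R f"
    if "f permutes UNIV" "bij_betw f T T" "bij_betw f U U" "bij_betw f R R" for f
  proof -
    have "sign f = sign_on UNIV f" using sign_on_permutes[OF that(1) subset_refl] by simp
    also have "UNIV = (T \<union> U) \<union> R" by (auto simp: T_def U_def R_def)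
    also have "sign_on \<dots> f = sign_on (T \<union> U) f * sign_on R f"
      using that by (intro sign_on_Un bij_betw_combine) (auto simp: T_def U_def R_def)
    also have "sign_on (T \<union> U) f = sign_on T f * sign_on U f"
      using that by (intro sign_on_Un) (auto simp: T_def U_def)
    finally show ?thesis .
  qed
  have "sign_on T p = sign_on T q" by (rule sign_on_cong) (auto simp: T_def)
  moreover have "sign_on U p = sign_on U q"
  proof -
    have "sign_on U q * sign_on U p = sign_on U (q \<circ> p)"
      using bij_p bij_q by (intro sign_on_compose[symmetric]) auto
    also have "\<dots> = sign_on U id" by (rule sign_on_cong) (auto simp: q_inv)
    finally have "sign_on U q * sign_on U p = 1" by simp
    then show ?thesis unfolding zmult_eq_1_iff by auto
  qed
  moreover have "sign_on R p = sign_on R q"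
  proof -
    have pp: "p (p v) = v" and qq: "q (q v) = v" if "v \<in> R" for v
      using that R_q[of v] by (auto simp: R_def)
    have "sign_on R p = (-1) ^ (card R div 2)"
      using pR pp nofix(1) by (intro sign_on_fixpoint_free_involution) auto
    moreover have "sign_on R q = (-1) ^ (card R div 2)"
      using qR qq nofix(2) by (intro sign_on_fixpoint_free_involution) auto
    ultimately show ?thesis by simp
  qed
  ultimately show ?thesis using split[OF p bij_p] split[OF q bij_q] by simp
qed

section \<open>Averaging the determinant against a character\<close>

text \<open>This is the exponent of the variable \<open>s e\<close> in the Leibniz monomial of
  \<open>p\<close>.\<close>

definition edge_traversals :: "('n::finite \<Rightarrow> 'n) \<Rightarrow> 'n set \<Rightarrow> nat" where
  "edge_traversals p e = card {i. {i, p i} = e}"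

lemma edge_traversals_doubleton:
  assumes "v \<noteq> w"
  shows "edge_traversals p {v, w} = of_bool (p v = w) + of_bool (p w = v)"
proof -
  have "{i. {i, p i} = {v, w}} = (if p v = w then {v} else {}) \<union> (if p w = v then {w} else {})"
    by (auto simp: doubleton_eq_iff)
  then show ?thesis using assms by (auto simp: edge_traversals_def)
qed

lemma prod_along_permutation:
  fixes s :: "'n::finite set \<Rightarrow> real"
  assumes "\<And>i. {i, p i} \<in> E"
  shows "(\<Prod>i\<in>UNIV. s {i, p i}) = (\<Prod>e\<in>E. s e ^ edge_traversals p e)"
proof -
  have "(\<Prod>e\<in>E. \<Prod>i\<in>{i. i \<in> UNIV \<and> {i, p i} = e}. s {i, p i}) = (\<Prod>i\<in>UNIV. s {i, p i})"
    using assms by (intro prod.group) auto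
  moreover have "(\<Prod>i\<in>{i. i \<in> UNIV \<and> {i, p i} = e}. s {i, p i}) = s e ^ edge_traversals p e" for e
    by (simp add: edge_traversals_def)
  ultimately show ?thesis by simp
qed

text \<open>Orthogonality of characters: the sum factors over the edges, and an edge contributes
  \<open>(-1) ^ k e + 1\<close>, which is 2 or 0.\<close>

lemma sum_edge_signings_monomial:
  assumes "finite E"
  shows "(\<Sum>s\<in>edge_signings E. \<Prod>e\<in>E. s e ^ k e) = (if \<forall>e\<in>E. even (k e) then 2 ^ card E else 0)"
proof -
  have "(\<Sum>s\<in>edge_signings E. \<Prod>e\<in>E. s e ^ k e) = (\<Prod>e\<in>E. \<Sum>y\<in>{-1, 1}. y ^ k e)"
    unfolding edge_signings_def by (rule prod_sum_PiE[symmetric]) (use assms in auto)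
  also have "\<dots> = (\<Prod>e\<in>E. if even (k e) then 2 else 0)"
    by (intro prod.cong) (auto simp: uminus_power_if)
  also have "\<dots> = (if \<forall>e\<in>E. even (k e) then 2 ^ card E else 0)"
    using assms by auto
  finally show ?thesis .
qed

text \<open>A permutation with some \<open>{i, q i}\<close> outside \<open>E\<close> picks up a zero
  entry; the surviving terms are pure monomials in the signs.\<close>

lemma det_signed_adjacency_matrix:
  "det (signed_adjacency_matrix E s) =
     (\<Sum>q | q permutes UNIV \<and> (\<forall>i. {i, q i} \<in> E). of_int (sign q) * (\<Prod>i\<in>UNIV. s {i, q i}))"
proof -
  have "(\<Prod>i\<in>UNIV. signed_adjacency_matrix E s $ i $ q i) =
      (if \<forall>i. {i, q i} \<in> E then \<Prod>i\<in>UNIV. s {i, q i} else 0)" for q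
    by (auto simp: signed_adjacency_matrix_def)
  then show ?thesis
    unfolding det_def by (intro sum.mono_neutral_cong_right) auto
qed

lemma abs_det_signed_adjacency_matrix_le:
  fixes E :: "'n::finite set set"
  assumes "s \<in> edge_signings E"
  shows "\<bar>det (signed_adjacency_matrix E s)\<bar> \<le> fact CARD('n)"
proof -
  let ?A = "signed_adjacency_matrix E s"
  have entry: "\<bar>?A $ i $ j\<bar> \<le> 1" for i j
    using assms by (auto simp: signed_adjacency_matrix_def edge_signings_def dest!: PiE_mem)
  have "\<bar>det ?A\<bar> \<le> (\<Sum>q | q permutes (UNIV :: 'n set). \<bar>of_int (sign q) * (\<Prod>i\<in>UNIV. ?A $ i $ q i)\<bar>)"
    unfolding det_def by (rule sum_abs)
  also have "\<dots> \<le> (\<Sum>q | q permutes (UNIV :: 'n set). 1)"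
    by (intro sum_mono)
      (auto simp: abs_mult abs_prod entry intro!: prod_le_1 simp flip: of_int_abs)
  also have "\<dots> = fact CARD('n)"
    using card_permutations[of "UNIV :: 'n set" "CARD('n)"] by simp
  finally show ?thesis .
qed

lemma sign_eq_if_even_edge_traversals:
  fixes E :: "'n::finite set set"
  assumes "simple_graph E"
    and p: "p permutes UNIV" "\<And>i. {i, p i} \<in> E" and q: "q permutes UNIV" "\<And>i. {i, q i} \<in> E"
    and even: "\<forall>e\<in>E. even (edge_traversals q e + edge_traversals p e)"
  shows "sign p = sign q"
proof (rule sign_eq_if_same_edge_parity)
  have card2: "card {i, p i} = 2" "card {i, q i} = 2" for i
    using assms(1) p(2) q(2) unfolding simple_graph_def by blast+
  show nofix: "p v \<noteq> v" "q v \<noteq> v" for v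
    using card2[of v] by (auto simp: card_insert_if split: if_splits)
  show "(p v = w \<longleftrightarrow> p w = v) \<longleftrightarrow> (q v = w \<longleftrightarrow> q w = v)" for v w
  proof (cases "v \<noteq> w \<and> {v, w} \<in> E")
    case True
    then have "even (edge_traversals q {v, w} + edge_traversals p {v, w})" using even by blast
    then show ?thesis using True
      by (auto simp: edge_traversals_doubleton of_bool_def split: if_splits)
  next
    \<comment> \<open>A loop or a non-edge is used by neither permutation, so both equivalences hold
      with false sides.\<close>
    case False
    with p(2) q(2) nofix have "p v \<noteq> w" "p w \<noteq> v" "q v \<noteq> w" "q w \<noteq> v"
      by (metis insert_commute)+
    then show ?thesis by simp
  qed
qed (use p q in auto)

lemma sum_abs_det_ge:
  fixes E :: "'n::finite set set"
  assumes "simple_graph E" and p: "p permutes UNIV" "\<And>i. {i, p i} \<in> E"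
  shows "2 ^ card E \<le> (\<Sum>s\<in>edge_signings E. \<bar>det (signed_adjacency_matrix E s)\<bar>)"
proof -
  define Q where "Q = {q. q permutes UNIV \<and> (\<forall>i. {i, q i} \<in> E)}"
  define chi where "chi s = (\<Prod>i\<in>UNIV. s {i, p i})" for s :: "'n set \<Rightarrow> real"
  define c where "c q = (\<Sum>s\<in>edge_signings E. (\<Prod>i\<in>UNIV. s {i, q i}) * chi s)" for q
  have c: "c q = (if \<forall>e\<in>E. even (edge_traversals q e + edge_traversals p e) then 2 ^ card E else 0)"
    if "q \<in> Q" for q
  proof -
    have "c q = (\<Sum>s\<in>edge_signings E. \<Prod>e\<in>E. s e ^ (edge_traversals q e + edge_traversals p e))"
      using that p(2) unfolding c_def chi_def Q_def
      by (simp add: prod_along_permutation[where E = E] power_add prod.distrib)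
    then show ?thesis by (simp add: sum_edge_signings_monomial)
  qed
  \<comment> \<open>Where \<open>c q\<close> is nonzero, \<open>q\<close> and \<open>p\<close> have
    equal edge parities, so their signs agree and multiply to 1.\<close>
  have signed: "of_int (sign p) * of_int (sign q) * c q = c q" if "q \<in> Q" for q
    using sign_eq_if_even_edge_traversals[OF assms(1) p, of q] that c[OF that]
    by (auto simp: Q_def simp flip: of_int_mult)
  \<comment> \<open>For \<open>q = p\<close> every exponent is doubled, hence even; the other terms
    of the sum are nonnegative.\<close>
  have "2 ^ card E = c p" using p c[of p] by (simp add: Q_def)
  also have "\<dots> \<le> (\<Sum>q\<in>Q. c q)"
    using p c by (intro member_le_sum) (auto simp: Q_def)
  also have "\<dots> = (\<Sum>q\<in>Q. of_int (sign p) * of_int (sign q) * c q)"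
    by (simp add: signed)
  also have "\<dots> = of_int (sign p) * (\<Sum>s\<in>edge_signings E. det (signed_adjacency_matrix E s) * chi s)"
    unfolding c_def det_signed_adjacency_matrix Q_def[symmetric]
    by (subst sum_distrib_right, subst sum.swap) (simp add: sum_distrib_left mult_ac)
  also have "\<dots> \<le> \<bar>\<Sum>s\<in>edge_signings E. det (signed_adjacency_matrix E s) * chi s\<bar>"
    by (cases p rule: sign_cases) auto
  also have "\<dots> \<le> (\<Sum>s\<in>edge_signings E. \<bar>det (signed_adjacency_matrix E s) * chi s\<bar>)"
    by (rule sum_abs)
  also have "\<dots> = (\<Sum>s\<in>edge_signings E. \<bar>det (signed_adjacency_matrix E s)\<bar>)"
  proof (rule sum.cong)
    fix s assume "s \<in> edge_signings E"
    then have "\<bar>s {i, p i}\<bar> = 1" for i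
      using PiE_mem[OF _ p(2)[of i]] by (force simp: edge_signings_def)
    then show "\<bar>det (signed_adjacency_matrix E s) * chi s\<bar> = \<bar>det (signed_adjacency_matrix E s)\<bar>"
      by (simp add: chi_def abs_mult abs_prod)
  qed simp
  finally show ?thesis .
qed

theorem theorem6:
  fixes E :: "'n::finite set set" and n m :: nat
  assumes "simple_graph E"
    and "n = CARD('n)"
    and "m = card E"
    and "\<exists>x. perfect_2_matching E x"
  shows "real (card {s \<in> edge_signings E. invertible (signed_adjacency_matrix E s)})
           \<ge> 2 powi (int m - int n) / fact n"
proof -
  let ?S = "{s \<in> edge_signings E. invertible (signed_adjacency_matrix E s)}"
  obtain p where p: "p permutes UNIV" "\<And>i. {i, p i} \<in> E"
    using perfect_2_matching_imp_permutation assms by blast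
  have fin: "finite (edge_signings E)" by (simp add: edge_signings_def finite_PiE)
  \<comment> \<open>The factor \<open>2 powi (- int n)\<close> is given up here.\<close>
  have "2 powi (int m - int n) \<le> (2 powi int m :: real)"
    by (intro power_int_increasing) auto
  also have "\<dots> = 2 ^ card E" by (simp add: assms)
  also have "\<dots> \<le> (\<Sum>s\<in>edge_signings E. \<bar>det (signed_adjacency_matrix E s)\<bar>)"
    using sum_abs_det_ge assms(1) p by blast
  \<comment> \<open>Singular signings have determinant zero; each of the others contributes at most
    \<open>fact n\<close>.\<close>
  also have "\<dots> = (\<Sum>s\<in>?S. \<bar>det (signed_adjacency_matrix E s)\<bar>)"
    using fin by (intro sum.mono_neutral_right) (auto simp: invertible_det_nz)
  also have "\<dots> \<le> (\<Sum>s\<in>?S. fact n)"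
    using assms(2) by (intro sum_mono) (auto intro: abs_det_signed_adjacency_matrix_le)
  also have "\<dots> = real (card ?S) * fact n" by simp
  finally show ?thesis by (simp add: divide_le_eq)
qed

end
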